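(* Let $L\ge 1$ and let $p=a_1a_2\cdots a_L$, $a_i\in\{0,1\}$, be a path of length $L$ such that for every $1\le i\le L$ one has $\#\{c\in[i,L] : a_c=1\}\le \#\{c\in[i,L] : a_c=0\}$. Let $L_1>L_2>\cdots>L_s$, the multiplicities $m_{L_1},\dots,m_{L_s}$ and the positions of 0-solitons $x^{(i)}_1\le x^{(i)}_2\le\cdots\le x^{(i)}_{m_{L_i}}$ $(1\le i\le s)$ be the data attached to $p$ by the 10-elimination algorithm, and let $(\nu,J)$ be the rigged configuration attached to $p$ by the RC-algorithm, regarded as the multiset of pairs (length of a row of $\nu$, rigging of that row). Then, as multisets, $$(\nu,J)=\{(L_i,\;x^{(i)}_\alpha-L_i)\}_{1\le i\le s,\;1\le\alpha\le m_{L_i}}.$$ That is, $\nu=(L_1^{m_{L_1}},L_2^{m_{L_2}},\dots,L_s^{m_{L_s}})$, and for each $i$ the riggings of the rows of length $L_i$ of $\nu$, listed in weakly increasing order, are $x^{(i)}_1-L_i\le\cdots\le x^{(i)}_{m_{L_i}}-L_i$.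
   Context: **Paths.** A path of length $L$ (of type $B_1^{\otimes L}$ for $A^{(1)}_1$) is a word $p=a_1a_2\cdots a_L$ with $a_i\in\{0,1\}$. In the periodic box-ball system a path comes from a word on a circle with at least as many 0's as 1's, cut at a position such that, when the 1 and 0 of each 10-pair erased during the 10-elimination below are joined by an arc (from the 1 to the 0), no arc crosses the cut. For the linear word $p$ this says that every suffix of $p$ contains at least as many 0's as 1's, which is the hypothesis of the claim. **10-elimination algorithm.** Put $E^0(p)=p$. A 10-pair of a word is a pair of adjacent letters, a 1 at location $j$ and a 0 at location $j+1$. For $k\ge1$, the word $E^k(p)$ is obtained from $E^{k-1}(p)$ by simultaneously erasing all 10-pairs of $E^{k-1}(p)$; the procedure stops when the word contains no letter 1. The letters of each word $E^k(p)$ are given coordinates $1,2,3,\dots$ from left to right (so coordinates are relative to $E^k(p)$, not to $p$). Let $e_k$ be the number of 10-pairs in $E^k(p)$; then $e_0\ge e_1\ge\cdots$. The conjugate (transposed) partition of $(e_0,e_1,e_2,\dots)$ is written ${}^t(e_0,e_1,\dots)=(L_1^{m_{L_1}},\dots,L_s^{m_{L_s}})$, with distinct parts $L_1>\cdots>L_s\geq 1$ and $m_{L_i}\ge 1$ the multiplicity of $L_i$. **0-solitons.** Let $k\ge1$. Consider a maximal block $(10)^m$, $m>0$, of consecutive 10-pairs in $E^{k-1}(p)$, say $E^{k-1}(p)=\cdots X(10)^mY\cdots$, where $X,Y$ are the letters adjacent to the block. These survive, so that $E^k(p)=\cdots XY\cdots$. If $XY\in\{11,01,00\}$, the block contributes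 $m$ 0-solitons located at the position (coordinate in $E^k(p)$) of $X$. If $XY=10$, it contributes $m-1$ 0-solitons located at the position of $X$ in $E^k(p)$. Boundary conventions: if the block is at the left end of $E^{k-1}(p)$, so that there is no $X$, it contributes $m$ 0-solitons at position $0$; if the block is at the right end, so that there is no $Y$, it contributes $m$ 0-solitons at the position of $X$ (or at position $0$ if there is no $X$ either). The total number of 0-solitons of $E^{k}(p)$ is $e_{k-1}-e_k$; in particular $E^{L_i}(p)$ has exactly $m_{L_i}$ 0-solitons. Their positions, with multiplicity, are denoted $x^{(i)}_1\le\cdots\le x^{(i)}_{m_{L_i}}$. **RC-algorithm (rigged configuration bijection for $A^{(1)}_1$).** A rigged configuration is a partition $\nu$ together with an integer, called a rigging, attached to each row of $\nu$; the order of the riggings among rows of equal length is irrelevant. For a partition $\nu$ put $Q_i(\nu)=\sum_a\min(i,\nu_a)$. Let $b_1<b_2<\cdots<b_n$ be the positions of the letter 1 in $p$ (the second row of the two-row tabloid of $p$). The rigged configuration of $p$ is built by inserting $b_1,\dots,b_n$ successively, starting from the empty partition: - Insert $b_1$: create one row of length 1 with rigging $b_1-2$. - Suppose $b_1,\dots,b_k$ have produced the partition $\tilde\nu$ with riggings. - If $b_{k+1}-b_k>1$: add to $\tilde\nu$ a new row of length 1 with rigging $b_{k+1}-2(\ell(\tilde\nu)+1)$, where $\ell(\tilde\nu)$ is the number of rows of $\tilde\nu$. All other rows and riggings are unchanged. - If $b_{k+1}-b_k=1$: call a row of $\tilde\nu$ of length $i$ singular if its rigging equals the vacancy number $b_k-2Q_i(\tilde\nu)$.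 (At least one singular row exists.) Choose a singular row of maximal length, say of length $r$, and lengthen it by one box, giving a partition $\nu$. The lengthened row, of length $r+1$, gets the new rigging $b_{k+1}-2Q_{r+1}(\nu)$. All other rows and riggings are unchanged. The result after inserting $b_n$ is the rigged configuration $(\nu,J)$ of $p$. *)

theory Defs
  imports "HOL-Library.Multiset"
begin

text \<open>
  Words are lists over \<open>{0, 1}\<close>. Lists are indexed from 0 whereas the coordinates in a word
  start at 1, so the letter at location \<open>c\<close> of \<open>w\<close> is \<open>w ! (c - 1)\<close>. The auxiliary sets
  \<open>pairs10\<close>, \<open>erased\<close> and \<open>blocks10\<close> consist of list indices; positions of letters and of
  0-solitons are coordinates.
\<close>

definition pairs10 :: "nat list \<Rightarrow> nat set" where
  "pairs10 w = {j. Suc j < length w \<and> w ! j = 1 \<and> w ! Suc j = 0}"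

definition erased :: "nat list \<Rightarrow> nat set" where
  "erased w = pairs10 w \<union> Suc ` pairs10 w"

definition elim10 :: "nat list \<Rightarrow> nat list" where
  "elim10 w = nths w (- erased w)"

text \<open>
  A word without the letter 1 is a fixed point of \<open>elim10\<close>, so iterating beyond the step at which
  the procedure stops only adds zeros to the sequence \<open>num10\<close>.
\<close>

definition E :: "nat \<Rightarrow> nat list \<Rightarrow> nat list" where
  "E k p = (elim10 ^^ k) p"

definition num10 :: "nat list \<Rightarrow> nat \<Rightarrow> nat" where
  "num10 p k = card (pairs10 (E k p))"

text \<open>
  The conjugate of a weakly decreasing, eventually zero sequence \<open>e 0, e 1, \<dots>\<close>, as the multiset
  of its positive parts.
\<close>

definition conjugate :: "(nat \<Rightarrow> nat) \<Rightarrow> nat multiset" where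
  "conjugate e = image_mset (\<lambda>j. card {k. j \<le> e k}) (mset_set {1..e 0})"

text \<open>
  \<open>(s, m)\<close> stands for a maximal block \<open>(10)\<^sup>m\<close> occupying the list indices \<open>s, \<dots>, s + 2 m - 1\<close>.
  The adjacent letters \<open>X\<close> and \<open>Y\<close> have list indices \<open>s - 1\<close> (if \<open>s > 0\<close>) and \<open>s + 2 m\<close>
  (if this is less than the length).
\<close>

definition blocks10 :: "nat list \<Rightarrow> (nat \<times> nat) set" where
  "blocks10 w = {(s, m). 0 < m \<and> (\<forall>i<m. s + 2 * i \<in> pairs10 w)
     \<and> s + 2 * m \<notin> pairs10 w \<and> (\<forall>r\<in>pairs10 w. r + 2 \<noteq> s)}"

definition block_contribution :: "nat list \<Rightarrow> nat \<Rightarrow> nat \<Rightarrow> nat" where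
  "block_contribution w s m =
     (if 0 < s \<and> s + 2 * m < length w \<and> w ! (s - 1) = 1 \<and> w ! (s + 2 * m) = 0
      then m - 1 else m)"

text \<open>
  The coordinate of \<open>X\<close> in \<open>elim10 w\<close> is the number of surviving letters of \<open>w\<close> up to and
  including \<open>X\<close>, that is, among the list indices below \<open>s\<close>. It is 0 if there is no \<open>X\<close>.
\<close>

definition block_position :: "nat list \<Rightarrow> nat \<Rightarrow> nat" where
  "block_position w s = card ({..<s} - erased w)"

text \<open>Positions of the 0-solitons of \<open>E k p\<close>, for \<open>k \<ge> 1\<close>.\<close>

definition zero_solitons :: "nat list \<Rightarrow> nat \<Rightarrow> nat multiset" where
  "zero_solitons p k =
     (let w = E (k - 1) p
      in \<Sum>(s, m)\<in>blocks10 w. replicate_mset (block_contribution w s m) (block_position w s))"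

definition zero_soliton_list :: "nat list \<Rightarrow> nat \<Rightarrow> nat list" where
  "zero_soliton_list p k = sorted_list_of_multiset (zero_solitons p k)"

text \<open>A rigged configuration is a multiset of pairs (length of a row, rigging of that row).\<close>

type_synonym rigged_configuration = "(nat \<times> int) multiset"

definition shape :: "rigged_configuration \<Rightarrow> nat multiset" where
  "shape R = image_mset fst R"

definition riggings :: "rigged_configuration \<Rightarrow> nat \<Rightarrow> int multiset" where
  "riggings R l = image_mset snd (filter_mset (\<lambda>row. fst row = l) R)"

definition Q :: "nat \<Rightarrow> nat multiset \<Rightarrow> int" where
  "Q i \<nu> = (\<Sum>a\<in>#\<nu>. int (min i a))"

text \<open>
  Singular rows of the same length have the same rigging, so the choice of a singular row of
  maximal length does not affect the result as a multiset.
\<close>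

definition singular_lengths :: "nat \<Rightarrow> rigged_configuration \<Rightarrow> nat set" where
  "singular_lengths b R = {i. (i, int b - 2 * Q i (shape R)) \<in># R}"

definition add_row :: "nat \<Rightarrow> rigged_configuration \<Rightarrow> rigged_configuration" where
  "add_row b R = add_mset (1, int b - 2 * (int (size R) + 1)) R"

definition lengthen_row :: "nat \<Rightarrow> nat \<Rightarrow> rigged_configuration \<Rightarrow> rigged_configuration" where
  "lengthen_row b b' R =
     (let r = Max (singular_lengths b R);
          R' = R - {#(r, int b - 2 * Q r (shape R))#};
          \<nu> = add_mset (r + 1) (shape R')
      in add_mset (r + 1, int b' - 2 * Q (r + 1) \<nu>) R')"

definition rc_insert :: "nat \<Rightarrow> nat \<Rightarrow> rigged_configuration \<Rightarrow> rigged_configuration" where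
  "rc_insert b b' R = (if b' - b > 1 then add_row b' R else lengthen_row b b' R)"

text \<open>\<open>rc_continue b bs R\<close> inserts \<open>bs\<close> into \<open>R\<close>, where \<open>b\<close> was inserted last.\<close>

fun rc_continue :: "nat \<Rightarrow> nat list \<Rightarrow> rigged_configuration \<Rightarrow> rigged_configuration" where
  "rc_continue b [] R = R"
| "rc_continue b (b' # bs) R = rc_continue b' bs (rc_insert b b' R)"

fun rc_of_positions :: "nat list \<Rightarrow> rigged_configuration" where
  "rc_of_positions [] = {#}"
| "rc_of_positions (b # bs) = rc_continue b bs {#(1, int b - 2)#}"

definition one_positions :: "nat list \<Rightarrow> nat list" where
  "one_positions p = filter (\<lambda>c. p ! (c - 1) = 1) [1..<Suc (length p)]"

definition RC :: "nat list \<Rightarrow> rigged_configuration" where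
  "RC p = rc_of_positions (one_positions p)"

end

theory Submission
  imports Defs
begin

text \<open>
  Put \<open>e = elim10 w\<close>. The 0-solitons of \<open>e\<close> are the positions of the pairs of \<open>w\<close> with those of the
  pairs of \<open>e\<close> removed, and the soliton side of the theorem for \<open>w\<close> is obtained from the one for
  \<open>e\<close> by turning each \<open>(l, r)\<close> into \<open>(l + 1, r - 1)\<close> and adding the rows of length 1. The claim is
  proved for every prefix of the path, padded by zeros, by induction on the prefix. A new 1 that does not
  follow a 1 adds one row of length 1. For a 1 following a 1, either its effect on \<open>w\<close> is the same kind
  of step on \<open>e\<close>, one level higher, or a row of length 1 disappears and a row of length 1 appears for
  \<open>e\<close>, that is, of length 2 for \<open>w\<close>. Since the vacancy numbers of \<open>w\<close> and \<open>e\<close> obey the same shift,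
  singular rows correspond, and a bound of the riggings by the vacancy numbers shows that
  the row lengthened is a singular row of maximal length.
\<close>

section \<open>Pairs and one round of elimination under concatenation\<close>

declare One_nat_def [simp del]

definition ends1 :: "nat list \<Rightarrow> bool" where
  "ends1 w \<longleftrightarrow> w \<noteq> [] \<and> last w = 1"

lemma ends1_simps [simp]: "\<not> ends1 []" "ends1 (w @ [a]) \<longleftrightarrow> a = 1"
  by (auto simp: ends1_def)

lemma ends1E:
  assumes "ends1 w" obtains u where "w = u @ [1]"
  using assms by (metis append_butlast_last_id ends1_def)

lemma finite_pairs10 [simp]: "finite (pairs10 w)"
  by (rule finite_subset[of _ "{..<length w}"]) (auto simp: pairs10_def)

lemma pairs10_bound: "j \<in> pairs10 w \<Longrightarrow> Suc j < length w"
  by (simp add: pairs10_def)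

text \<open>The hypothesis excludes the only pair that could straddle the junction. The same
  condition reappears wherever a word is cut.\<close>

lemma pairs10_append:
  assumes "\<not> (ends1 u \<and> x \<noteq> [] \<and> hd x = 0)"
  shows "pairs10 (u @ x) = pairs10 u \<union> (+) (length u) ` pairs10 x"
proof (intro set_eqI iffI)
  fix j assume j: "j \<in> pairs10 (u @ x)"
  consider "Suc j < length u" | "Suc j = length u" | "j \<ge> length u" by linarith
  then show "j \<in> pairs10 u \<union> (+) (length u) ` pairs10 x"
  proof cases
    case 1 then show ?thesis using j by (simp add: pairs10_def nth_append)
  next
    case 2
    then have "u \<noteq> []" by auto
    moreover from this have "last u = u ! j" using last_conv_nth[of u] by (auto simp flip: 2)
    ultimately show ?thesis using 2 j assms
      by (cases x) (auto simp: pairs10_def nth_append ends1_def)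
  next
    case 3
    then have "j - length u \<in> pairs10 x"
      using j by (auto simp: pairs10_def nth_append Suc_diff_le)
    with 3 show ?thesis by force
  qed
next
  fix j assume "j \<in> pairs10 u \<union> (+) (length u) ` pairs10 x"
  then show "j \<in> pairs10 (u @ x)"
    by (auto simp: pairs10_def nth_append)
qed

lemma pairs10_small [simp]: "pairs10 [] = {}" "pairs10 [a] = {}" "pairs10 [1, 0] = {0}"
  by (auto simp: pairs10_def less_Suc_eq nth_Cons')

lemma pairs10_zeros [simp]: "pairs10 (replicate n 0) = {}"
  by (auto simp: pairs10_def)

lemma pairs10_insert_pair: "pairs10 (u @ 1 # 0 # x) = pairs10 u \<union> {length u} \<union> (+) (length u + 2) ` pairs10 x"
proof -
  have "pairs10 (u @ [1] @ [0] @ x) = pairs10 u \<union> (+) (length u) ` pairs10 ([1, 0] @ x)"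
    by (subst pairs10_append) auto
  also have "pairs10 ([1, 0] @ x) = {0} \<union> (+) 2 ` pairs10 x"
    by (subst pairs10_append) (auto simp: ends1_def)
  finally show ?thesis by (auto simp: image_Un image_image add.assoc)
qed

lemma erased_append:
  assumes "\<not> (ends1 u \<and> x \<noteq> [] \<and> hd x = 0)"
  shows "erased (u @ x) = erased u \<union> (+) (length u) ` erased x"
  using pairs10_append[OF assms] by (auto simp: erased_def image_Un image_image)

lemma erased_bound: "i \<in> erased w \<Longrightarrow> i < length w"
  by (auto simp: erased_def dest!: pairs10_bound)

lemma nths_cong_set:
  assumes "\<And>i. i < length w \<Longrightarrow> i \<in> A \<longleftrightarrow> i \<in> B"
  shows "nths w A = nths w B"
  unfolding nths_def by (intro arg_cong[where f = "map fst"] filter_cong) (auto simp: set_zip assms)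

lemma elim10_append:
  assumes "\<not> (ends1 u \<and> x \<noteq> [] \<and> hd x = 0)"
  shows "elim10 (u @ x) = elim10 u @ elim10 x"
proof -
  have "nths u (- erased (u @ x)) = nths u (- erased u)"
    unfolding erased_append[OF assms] 
    by (intro nths_cong_set) auto
  moreover have "{j. j + length u \<in> - erased (u @ x)} = - erased x"
    unfolding erased_append[OF assms] by (auto dest: erased_bound simp: image_iff)
  ultimately show ?thesis by (simp add: elim10_def nths_append)
qed

lemma elim10_no_pairs: "pairs10 w = {} \<Longrightarrow> elim10 w = w"
  by (simp add: elim10_def erased_def nths_all)

lemma elim10_small [simp]: "elim10 [] = []" "elim10 [a] = [a]" "elim10 (replicate n 0) = replicate n 0"
  by (simp_all add: elim10_no_pairs)

text \<open>Even if \<open>u\<close> ends in 1 and \<open>x\<close> begins with 0, these letters are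
  not adjacent in the present round; the pair they form afterwards waits for the next one.\<close>

lemma elim10_insert_pair: "elim10 (u @ 1 # 0 # x) = elim10 u @ elim10 x"
proof -
  have "erased [1, 0] = {0, Suc 0}" by (auto simp: erased_def)
  then have "elim10 [1, 0] = []" by (simp add: elim10_def nths_Cons)
  then have "elim10 ([1, 0] @ x) = elim10 x" by (subst elim10_append) (auto simp: ends1_def)
  moreover have "elim10 (u @ [1] @ [0] @ x) = elim10 u @ elim10 ([1, 0] @ x)"
    by (subst elim10_append) auto
  ultimately show ?thesis by simp
qed

lemma finite_erased [simp]: "finite (erased w)"
  by (simp add: erased_def)

lemma card_erased: "card (erased w) = 2 * card (pairs10 w)"
proof -
  have "pairs10 w \<inter> Suc ` pairs10 w = {}" by (auto simp: pairs10_def)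
  then show ?thesis by (simp add: erased_def card_Un_disjoint card_image)
qed

lemma length_elim10: "length (elim10 w) + 2 * card (pairs10 w) = length w"
proof -
  have "length (elim10 w) = card ({..<length w} - erased w)"
    by (auto simp: elim10_def length_nths intro: arg_cong[where f = card])
  also have "\<dots> + card (erased w) = length w"
    using card_Diff_subset[of "erased w" "{..<length w}"] card_mono[of "{..<length w}" "erased w"] erased_bound
    by force
  finally show ?thesis by (simp add: card_erased)
qed

section \<open>Positions of pairs in the reduced word\<close>

lemma block_position_append:
  assumes "\<not> (ends1 u \<and> x \<noteq> [] \<and> hd x = 0)" "j \<le> length u"
  shows "block_position (u @ x) j = block_position u j"
  unfolding block_position_def erased_append[OF assms(1)]
  using assms(2) by (intro arg_cong[where f = card]) auto

lemma block_position_length: "block_position w (length w) = length (elim10 w)"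
  by (auto simp: block_position_def elim10_def length_nths intro: arg_cong[where f = card])

lemma block_position_le: 
  assumes "j \<le> length w" shows "block_position w j \<le> length (elim10 w)"
  unfolding block_position_length[symmetric] block_position_def
  using assms by (intro card_mono) auto

text \<open>All pairs of one block have the same value here, the location of the block, because
  everything between them is erased.\<close>

definition pair_positions :: "nat list \<Rightarrow> nat multiset" where
  "pair_positions w = image_mset (block_position w) (mset_set (pairs10 w))"

text \<open>Coordinates start at 1, so \<open>Suc\<close> gives the coordinate of the letter 1 of
  each pair. In \<open>elim10 w\<close> this is the letter \<open>X\<close> of the block whose
  removal created the pair.\<close>

definition right_ends :: "nat list \<Rightarrow> nat multiset" where
  "right_ends w = image_mset Suc (mset_set (pairs10 w))"

lemma block_position_insert_pair:
  assumes "j \<le> length u"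
  shows "block_position (u @ 1 # 0 # x) j = block_position u j"
  using block_position_append[of u "1 # 0 # x" j] assms by simp

lemma pair_positions_append_no_pairs:
  assumes "\<not> (ends1 u \<and> x \<noteq> [] \<and> hd x = 0)" "pairs10 x = {}"
  shows "pair_positions (u @ x) = pair_positions u"
  unfolding pair_positions_def pairs10_append[OF assms(1)]
  using assms by (auto intro!: image_mset_cong block_position_append dest!: pairs10_bound)

lemma pair_positions_insert_pair:
  assumes "pairs10 x = {}"
  shows "pair_positions (u @ 1 # 0 # x) = add_mset (length (elim10 u)) (pair_positions u)"
proof -
  have "length u \<notin> pairs10 u" by (auto dest!: pairs10_bound)
  moreover have "image_mset (block_position (u @ 1 # 0 # x)) (mset_set (pairs10 u)) = pair_positions u"
    unfolding pair_positions_def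
    by (auto intro!: image_mset_cong block_position_insert_pair dest!: pairs10_bound)
  ultimately show ?thesis
    by (simp add: pair_positions_def pairs10_insert_pair assms block_position_insert_pair block_position_length)
qed

lemma right_ends_append_no_pairs:
  assumes "\<not> (ends1 u \<and> x \<noteq> [] \<and> hd x = 0)" "pairs10 x = {}"
  shows "right_ends (u @ x) = right_ends u"
  by (simp add: right_ends_def pairs10_append assms)

lemma right_ends_insert_pair:
  assumes "pairs10 x = {}"
  shows "right_ends (u @ 1 # 0 # x) = add_mset (Suc (length u)) (right_ends u)"
proof -
  have "length u \<notin> pairs10 u" by (auto dest!: pairs10_bound)
  then show ?thesis by (simp add: right_ends_def pairs10_insert_pair assms)
qed

section \<open>Maximal blocks and their 0-solitons\<close>

definition solitons :: "nat list \<Rightarrow> nat multiset" where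
  "solitons w = (\<Sum>(s, m)\<in>blocks10 w. replicate_mset (block_contribution w s m) (block_position w s))"

definition pair_power :: "nat \<Rightarrow> nat list" where
  "pair_power m = concat (replicate m [1, 0])"

lemma pair_power_simps [simp]: "pair_power 0 = []" "pair_power (Suc m) = 1 # 0 # pair_power m"
  by (simp_all add: pair_power_def)

lemma length_pair_power [simp]: "length (pair_power m) = 2 * m"
  by (induction m) auto

lemma finite_blocks10 [simp]: "finite (blocks10 w)"
proof (rule finite_subset)
  show "blocks10 w \<subseteq> {..length w} \<times> {..length w}"
  proof clarify
    fix s m assume sm: "(s, m) \<in> blocks10 w"
    then have "s + 2 * (m - 1) \<in> pairs10 w" "m > 0" by (auto simp: blocks10_def)
    then show "s \<in> {..length w} \<and> m \<in> {..length w}" using pairs10_bound by fastforce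
  qed
qed simp

lemma blocks10_pairs: "(s, m) \<in> blocks10 w \<Longrightarrow> 0 < m \<and> s + 2 * (m - 1) \<in> pairs10 w"
  by (auto simp: blocks10_def)

text \<open>The word \<open>t @ pair_power m @ y\<close> is cut around its last maximal block: no
  pair follows in \<open>y\<close>, and \<open>t\<close> does not end in a pair that would prolong
  the block to the left. Inductions can then remove one block at a time.\<close>

context
  fixes t y :: "nat list" and m :: nat
  assumes m: "0 < m" and y: "pairs10 y = {}" and t: "\<And>u. t \<noteq> u @ [1, 0]"
begin

lemma pair_power_insert_aux:
  "pairs10 (u @ pair_power k @ y) = pairs10 u \<union> (\<lambda>i. length u + 2 * i) ` {..<k}" if "k > 0"
  using that
proof (induction k arbitrary: u)
  case (Suc k)
  show ?case
  proof (cases "k = 0")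
    case True
    then show ?thesis by (auto simp: pairs10_insert_pair y)
  next
    case False
    then have "pairs10 ((u @ [1, 0]) @ pair_power k @ y)
        = pairs10 (u @ [1, 0]) \<union> (\<lambda>i. length (u @ [1, 0]) + 2 * i) ` {..<k}"
      using Suc.IH by blast
    moreover have "pairs10 (u @ [1, 0]) = insert (length u) (pairs10 u)"
      using pairs10_insert_pair[of u "[]"] by simp
    moreover have "{..<Suc k} = insert 0 (Suc ` {..<k})" by (rule lessThan_Suc_eq_insert_0)
    ultimately show ?thesis by (simp add: image_image)
  qed
qed simp

lemma pairs10_last_block:
  "pairs10 (t @ pair_power m @ y) = pairs10 t \<union> (\<lambda>i. length t + 2 * i) ` {..<m}"
  using pair_power_insert_aux m .

text \<open>A pair at the very end of \<open>t\<close> would belong to the block. The resulting gap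
  keeps all earlier blocks, together with their letter \<open>Y\<close>, inside
  \<open>t\<close>.\<close>

lemma pairs10_t_bound:
  assumes "j \<in> pairs10 t" shows "j + 2 < length t"
proof (rule ccontr)
  assume "\<not> j + 2 < length t"
  with assms have "length t = j + 2" by (auto simp: pairs10_def)
  with assms have "t = take j t @ [1, 0]"
    by (intro nth_equalityI) (auto simp: pairs10_def nth_append nth_Cons' not_less le_less_Suc_eq)
  with t show False by blast
qed

lemma blocks10_last_block: "blocks10 (t @ pair_power m @ y) = insert (length t, m) (blocks10 t)"
proof -
  let ?w = "t @ pair_power m @ y" and ?l = "length t"
  have in_t: "j \<in> pairs10 ?w \<longleftrightarrow> j \<in> pairs10 t" if "j < ?l" for j
    using that by (auto simp: pairs10_last_block)
  have in_block: "?l + 2 * i \<in> pairs10 ?w \<longleftrightarrow> i < m" for i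
    using pairs10_t_bound by (fastforce simp: pairs10_last_block)
  have "(s, k) \<in> blocks10 ?w \<longleftrightarrow> (s, k) = (?l, m) \<or> (s, k) \<in> blocks10 t" for s k
  proof
    assume "(s, k) \<in> blocks10 ?w"
    then have k: "0 < k" "\<And>i. i < k \<Longrightarrow> s + 2 * i \<in> pairs10 ?w" "s + 2 * k \<notin> pairs10 ?w"
      "\<And>r. r \<in> pairs10 ?w \<Longrightarrow> r + 2 \<noteq> s" by (auto simp: blocks10_def)
    then have "s \<in> pairs10 ?w" by force
    then consider "s \<in> pairs10 t" | i where "s = ?l + 2 * i" "i < m"
      by (auto simp: pairs10_last_block)
    then show "(s, k) = (?l, m) \<or> (s, k) \<in> blocks10 t"
    proof cases
      case 1
      have "s + 2 * i \<in> pairs10 t" if "i < k" for i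
        using that
      proof (induction i)
        case (Suc i)
        then have "s + 2 * i + 2 < ?l" using pairs10_t_bound by simp
        then show ?case using in_t k(2)[OF Suc.prems] by simp
      qed (simp add: 1)
      then have "(s, k) \<in> blocks10 t" using k by (auto simp: blocks10_def pairs10_last_block)
      then show ?thesis ..
    next
      case 2
      \<comment> \<open>A later pair of the power has another pair two places to its left, so it
        cannot begin a maximal block.\<close>
      have "i = 0"
      proof (rule ccontr)
        assume "i \<noteq> 0"
        then have "?l + 2 * (i - 1) \<in> pairs10 ?w" "?l + 2 * (i - 1) + 2 = s"
          using 2 by (auto simp: in_block)
        with k(4) show False by blast
      qed
      with 2 have s: "s = ?l" by simp
      have "\<not> m < k" using k(2)[of m] in_block[of m] s by auto
      moreover have "\<not> k < m" using k(3) in_block[of k] s by auto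
      ultimately show ?thesis using s by simp
    qed
  next
    assume "(s, k) = (?l, m) \<or> (s, k) \<in> blocks10 t"
    then show "(s, k) \<in> blocks10 ?w"
    proof
      assume "(s, k) = (?l, m)"
      then show ?thesis
        using m in_block[of m] in_block pairs10_t_bound
        by (fastforce simp: blocks10_def pairs10_last_block)
    next
      assume sk: "(s, k) \<in> blocks10 t"
      then have "s + 2 * (k - 1) + 2 < ?l" using blocks10_pairs pairs10_t_bound by blast
      then have "s + 2 * k < ?l" using blocks10_pairs[OF sk] by simp
      then show ?thesis using sk in_t by (auto simp: blocks10_def pairs10_last_block)
    qed
  qed
  then show ?thesis by auto
qed

lemma head_pair_power: "hd (pair_power m @ y) = 1"
  using m by (cases m) auto

lemma contribution_t:
  assumes "(s, k) \<in> blocks10 t"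
  shows "block_contribution (t @ pair_power m @ y) s k = block_contribution t s k"
    and "block_position (t @ pair_power m @ y) s = block_position t s"
proof -
  have "s + 2 * (k - 1) + 2 < length t" using blocks10_pairs pairs10_t_bound assms by blast
  then have "s + 2 * k < length t" using blocks10_pairs[OF assms] by simp
  then show "block_contribution (t @ pair_power m @ y) s k = block_contribution t s k"
    and "block_position (t @ pair_power m @ y) s = block_position t s"
    using head_pair_power
    by (auto simp: block_contribution_def nth_append intro!: block_position_append)
qed

lemma contribution_last:
  "block_contribution (t @ pair_power m @ y) (length t) m = (if ends1 t \<and> y \<noteq> [] \<and> hd y = 0 then m - 1 else m)"
  by (cases t rule: rev_cases; cases y) (auto simp: block_contribution_def nth_append)

lemma solitons_last_block:
  "solitons (t @ pair_power m @ y) = solitons t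
    + replicate_mset (if ends1 t \<and> y \<noteq> [] \<and> hd y = 0 then m - 1 else m) (length (elim10 t))"
proof -
  have "(length t, m) \<notin> blocks10 t" using blocks10_pairs pairs10_t_bound by fastforce
  moreover have "block_position (t @ pair_power m @ y) (length t) = length (elim10 t)"
    using head_pair_power by (subst block_position_append) (auto simp: block_position_length)
  moreover have "(\<Sum>(s, k)\<in>blocks10 t. replicate_mset (block_contribution (t @ pair_power m @ y) s k)
       (block_position (t @ pair_power m @ y) s)) = solitons t"
    unfolding solitons_def by (intro sum.cong) (auto simp: contribution_t)
  ultimately show ?thesis
    by (simp add: solitons_def blocks10_last_block contribution_last)
qed

lemma elim10_last_block: "elim10 (t @ pair_power m @ y) = elim10 t @ y"
proof -
  have "elim10 (pair_power k @ y) = y" for k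
    using elim10_insert_pair[of "[]"] by (induction k) (simp_all add: elim10_no_pairs y)
  then show ?thesis using m elim10_insert_pair[of t] by (cases m) auto
qed

lemma pair_positions_last_block:
  "pair_positions (t @ pair_power m @ y) = pair_positions t + replicate_mset m (length (elim10 t))"
proof -
  have *: "pair_positions (u @ pair_power k @ y) = pair_positions u + replicate_mset k (length (elim10 u))"
    if "k > 0" for u k using that
  proof (induction k arbitrary: u)
    case (Suc k)
    then show ?case
      using Suc.IH[of "u @ [1, 0]"] pair_positions_insert_pair[OF y, of u]
         pair_positions_insert_pair[of "[]" u] elim10_insert_pair[of u "[]"]
      by (cases "k = 0") auto
  qed simp
  then show ?thesis using m by blast
qed

end

lemma solitons_no_pairs: "pairs10 w = {} \<Longrightarrow> solitons w = {#}"
proof -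
  assume "pairs10 w = {}"
  then have "blocks10 w = {}" by (auto dest: blocks10_pairs)
  then show ?thesis by (simp add: solitons_def)
qed

lemma last_block_cases:
  assumes "pairs10 w \<noteq> {}"
  obtains t m y where "w = t @ pair_power m @ y" "0 < m" "pairs10 y = {}" "\<And>u. t \<noteq> u @ [1, 0]"
proof -
  define D where "D t \<longleftrightarrow> (\<exists>m y. w = t @ pair_power m @ y \<and> 0 < m \<and> pairs10 y = {})" for t
  define j where "j = Max (pairs10 w)"
  have j: "j \<in> pairs10 w" using assms by (simp add: j_def)
  then have w: "w = take j w @ 1 # 0 # drop (j + 2) w"
    using id_take_nth_drop[of j w] Cons_nth_drop_Suc[of "Suc j" w] by (simp add: pairs10_def)
  have "pairs10 (drop (j + 2) w) = {}"
  proof (rule ccontr)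
    assume "pairs10 (drop (j + 2) w) \<noteq> {}"
    then obtain r where "r \<in> pairs10 (drop (j + 2) w)" by blast
    then have "j + 2 + r \<in> pairs10 w" by (auto simp: pairs10_def)
    then have "j + 2 + r \<le> j" unfolding j_def by (intro Max_ge) auto
    then show False by simp
  qed
  \<comment> \<open>The rightmost pair gives a decomposition with \<open>m = 1\<close>. A shortest
    \<open>t\<close> cannot end in a pair, since that pair could be moved into the power.\<close>
  then have "D (take j w)" unfolding D_def using w
    by (intro exI[of _ "1::nat"] exI[of _ "drop (j + 2) w"]) (simp add: One_nat_def)
  then obtain t where t: "D t" and least: "\<And>u. D u \<Longrightarrow> length t \<le> length u"
    using ex_has_least_nat[of D _ length] by blast
  obtain m y where my: "w = t @ pair_power m @ y" "0 < m" "pairs10 y = {}"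
    using t by (auto simp: D_def)
  have "t \<noteq> u @ [1, 0]" for u
  proof
    assume "t = u @ [1, 0]"
    then have "D u" unfolding D_def using my
      by (intro exI[of _ "Suc m"] exI[of _ y]) simp
    then show False using least[of u] \<open>t = u @ [1, 0]\<close> by simp
  qed
  with my that show thesis by blast
qed

text \<open>
  A pair of \<open>elim10 w\<close> that is new compared to \<open>w\<close> arises exactly at a block with \<open>XY = 10\<close>,
  and every pair of \<open>elim10 w\<close> is new. So the solitons are obtained from the positions of all
  pairs of \<open>w\<close> by removing the positions of the pairs of \<open>elim10 w\<close>.
\<close>

lemma solitons_plus_right_ends: "solitons w + right_ends (elim10 w) = pair_positions w"
proof (induction "length w" arbitrary: w rule: less_induct)
  case less
  show ?case
  proof (cases "pairs10 w = {}")
    case True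
    then show ?thesis
      by (simp add: solitons_no_pairs elim10_no_pairs right_ends_def pair_positions_def)
  next
    case False
    then obtain t m y where w: "w = t @ pair_power m @ y"
      and m: "0 < m" and y: "pairs10 y = {}" and t: "\<And>u. t \<noteq> u @ [1, 0]"
      by (rule last_block_cases) blast
    have IH: "solitons t + right_ends (elim10 t) = pair_positions t"
      using less[of t] w m by simp
    note facts = solitons_last_block[OF m y t] elim10_last_block[OF m y t]
      pair_positions_last_block[OF m y t]
    show ?thesis
    proof (cases "ends1 t \<and> y \<noteq> [] \<and> hd y = 0")
      \<comment> \<open>Here \<open>XY = 10\<close>: closing the gap creates a pair whose 1 has
        coordinate \<open>length (elim10 t)\<close>, the location of the block. It makes up for the
        soliton missing in \<open>m - 1\<close>.\<close>
      case True
      then obtain t' y' where t': "t = t' @ [1]" "y = 0 # y'"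
        by (metis ends1E list.collapse)
      have y': "pairs10 y' = {}" using pairs10_append[of "[0]" y'] y t' by (auto simp: ends1_def)
      have e: "elim10 t = elim10 t' @ [1]" unfolding t' by (subst elim10_append) auto
      have "right_ends (elim10 t @ y) = add_mset (length (elim10 t)) (right_ends (elim10 t'))"
        using right_ends_insert_pair[OF y', of "elim10 t'"] unfolding e by (simp add: t')
      moreover have "right_ends (elim10 t) = right_ends (elim10 t')"
        unfolding e by (subst right_ends_append_no_pairs) auto
      moreover have "replicate_mset m x = add_mset x (replicate_mset (m - 1) x)" for x :: nat
        using m by (cases m) auto
      ultimately show ?thesis using IH True m unfolding w facts
        by (simp add: ac_simps flip: IH)
    next
      case False
      \<comment> \<open>As \<open>t\<close> does not end in a pair, its last letter \<open>X\<close>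
        survives as the last letter of \<open>elim10 t\<close>, so no pair forms at the
        junction.\<close>
      have "\<not> (ends1 (elim10 t) \<and> y \<noteq> [] \<and> hd y = 0)"
      proof (cases t rule: rev_cases)
        case (snoc t' a)
        have "\<not> (ends1 t' \<and> a = 0)" using t snoc by (auto elim: ends1E)
        then have "elim10 t = elim10 t' @ [a]"
          unfolding snoc by (subst elim10_append) auto
        then show ?thesis using False snoc by simp
      qed simp
      then have "right_ends (elim10 t @ y) = right_ends (elim10 t)"
        using right_ends_append_no_pairs y by blast
      then show ?thesis using IH False unfolding w facts if_not_P[OF False]
        by (simp add: ac_simps flip: IH)
    qed
  qed
qed

lemma size_solitons: "size (solitons w) + card (pairs10 (elim10 w)) = card (pairs10 w)"
  using arg_cong[OF solitons_plus_right_ends[of w], of size]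
  by (simp add: right_ends_def pair_positions_def)

section \<open>The rigged configuration built from the 0-solitons\<close>

lemma set_elim10: "set (elim10 w) \<subseteq> set w"
  by (simp add: elim10_def set_nths_subset)

lemma length_elim10_less: "pairs10 w \<noteq> {} \<Longrightarrow> length (elim10 w) < length w"
  using length_elim10[of w] card_gt_0_iff[of "pairs10 w"] by simp

text \<open>
  In \<open>E k p\<close> a soliton at \<open>x\<close> stands for the row \<open>(k, x - k)\<close>. Compared to \<open>E (k - 1) (elim10 p)\<close>
  the same word is one level higher, which turns \<open>(l, r)\<close> into \<open>(l + 1, r - 1)\<close>.
\<close>

definition level_one :: "nat multiset \<Rightarrow> rigged_configuration" where
  "level_one M = image_mset (\<lambda>x. (1, int x - 1)) M"

definition raise_level :: "rigged_configuration \<Rightarrow> rigged_configuration" where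
  "raise_level R = image_mset (\<lambda>(l, r). (Suc l, r - 1)) R"

text \<open>The configuration claimed by the theorem, built by recursion along the elimination
  instead of as a sum over levels, so that facts about \<open>elim10 w\<close> can be used
  inductively.\<close>

function soliton_rc :: "nat list \<Rightarrow> rigged_configuration" where
  "soliton_rc w = (if pairs10 w = {} then {#}
     else level_one (solitons w) + raise_level (soliton_rc (elim10 w)))"
  by auto
termination by (relation "measure length") (auto simp: length_elim10_less)

declare soliton_rc.simps [simp del]

lemma soliton_rc_no_pairs: "pairs10 w = {} \<Longrightarrow> soliton_rc w = {#}"
  by (simp add: soliton_rc.simps)

text \<open>For a word without pairs both summands are empty, so no case distinction
  remains.\<close>

lemma soliton_rc_unfold: "soliton_rc w = level_one (solitons w) + raise_level (soliton_rc (elim10 w))"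
  by (cases "pairs10 w = {}")
     (simp_all add: soliton_rc.simps[of w] solitons_no_pairs elim10_no_pairs soliton_rc_no_pairs level_one_def raise_level_def)

lemma size_soliton_rc: "size (soliton_rc w) = card (pairs10 w)"
proof (induction w rule: soliton_rc.induct)
  case (1 w)
  show ?case
  proof (cases "pairs10 w = {}")
    case False
    then show ?thesis using 1 size_solitons[of w]
      by (simp add: soliton_rc_unfold[of w] level_one_def raise_level_def)
  qed (simp add: soliton_rc_no_pairs)
qed

lemma Q_add [simp]: "Q i (\<mu> + \<nu>) = Q i \<mu> + Q i \<nu>" "Q i (add_mset a \<nu>) = int (min i a) + Q i \<nu>"
  "Q i {#} = 0"
  by (simp_all add: Q_def)

lemma shape_add [simp]: "shape (R + R') = shape R + shape R'" "shape {#} = {#}"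
  "shape (add_mset (l, r) R) = add_mset l (shape R)"
  by (simp_all add: shape_def)

lemma Q_level_one: "Q (Suc l) (shape (level_one M)) = int (size M)"
  by (induction M) (simp_all add: level_one_def)

lemma Q_raise_level: "Q (Suc l) (shape (raise_level R)) = int (size R) + Q l (shape R)"
  by (induction R) (auto simp: raise_level_def)

lemma Q_0 [simp]: "Q 0 \<nu> = 0"
  by (simp add: Q_def)

text \<open>The first column of the diagram has one box per pair of \<open>w\<close>, and deleting
  it leaves the shape for \<open>elim10 w\<close>. With \<open>length_elim10\<close>,
  \<open>length w - 2 * Q (Suc l)\<close> for \<open>w\<close> equals
  \<open>length (elim10 w) - 2 * Q l\<close> for \<open>elim10 w\<close>.\<close>

lemma Q_soliton_rc:
  "Q (Suc l) (shape (soliton_rc w)) = int (card (pairs10 w)) + Q l (shape (soliton_rc (elim10 w)))"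
  using size_solitons[of w]
  by (subst soliton_rc_unfold) (simp add: Q_level_one Q_raise_level size_soliton_rc)

lemma soliton_rc_rows_cases:
  assumes "(l, r) \<in># soliton_rc w"
  obtains x where "x \<in># solitons w" "l = 1" "r = int x - 1"
  | l' where "(l', r + 1) \<in># soliton_rc (elim10 w)" "l = Suc l'"
  using assms by (subst (asm) soliton_rc_unfold) (auto simp: level_one_def raise_level_def)

section \<open>Padded prefixes and the effect of one more letter 1\<close>

abbreviation zeros :: "nat \<Rightarrow> nat list" where
  "zeros n \<equiv> replicate n 0"

text \<open>
  A prefix of a path need not satisfy the suffix condition. It is therefore padded by zeros, so that
  every 1 has a partner; the riggings do not depend on the number of zeros.
\<close>

lemma elim10_zeros:
  assumes "\<not> ends1 u" shows "elim10 (u @ zeros n) = elim10 u @ zeros n"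
  using assms by (subst elim10_append) auto

text \<open>The new pair disappears in the first round, so both reduced words agree and only the
  first level gains a soliton, located behind all of \<open>elim10 u\<close>.\<close>

lemma soliton_rc_append_separate_one:
  assumes "\<not> ends1 u"
  shows "soliton_rc (u @ 1 # 0 # zeros n)
    = add_mset (1, int (length (elim10 u)) - 1) (soliton_rc (u @ zeros n))"
proof -
  let ?T = "u @ 1 # 0 # zeros n" and ?U = "u @ zeros n"
  have e: "elim10 ?T = elim10 ?U"
    using elim10_insert_pair[of u "zeros n"] by (simp add: elim10_zeros assms)
  have "pair_positions ?T = add_mset (length (elim10 u)) (pair_positions ?U)"
    using pair_positions_insert_pair[of "zeros n" u] pair_positions_append_no_pairs[of u "zeros n"] assms
    by simp
  then have "solitons ?T = add_mset (length (elim10 u)) (solitons ?U)"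
    using solitons_plus_right_ends[of ?T] solitons_plus_right_ends[of ?U] unfolding e
    by (metis add_right_imp_eq union_mset_add_mset_left)
  then show ?thesis
    using soliton_rc_unfold[of ?T] soliton_rc_unfold[of ?U] unfolding e
    by (simp add: level_one_def)
qed

lemma pairs10_append_zeros:
  assumes "\<not> ends1 u" shows "pairs10 (u @ zeros n) = pairs10 u"
  using assms by (subst pairs10_append) auto

lemma card_pairs10_insert_pair: "card (pairs10 (u @ 1 # 0 # zeros n)) = Suc (card (pairs10 u))"
proof -
  have "length u \<notin> pairs10 u" by (auto dest: pairs10_bound)
  then show ?thesis by (simp add: pairs10_insert_pair)
qed

lemma solitons_le_length:
  assumes "x \<in># solitons (u @ 1 # 0 # zeros n)"
  shows "x \<le> length (elim10 u)"
proof -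
  have "x \<in># pair_positions (u @ 1 # 0 # zeros n)"
    using assms by (simp flip: solitons_plus_right_ends)
  then have "x \<in># add_mset (length (elim10 u)) (pair_positions u)"
    by (simp add: pair_positions_insert_pair)
  then show ?thesis
    by (auto simp: pair_positions_def intro!: block_position_le dest!: pairs10_bound)
qed

text \<open>A final 0 is absorbed by the padding. For a final 1, first-level rows are bounded by the
  positions of solitons, and any other row comes from a shorter word in which its rigging and its
  vacancy number are both larger by one.\<close>

lemma soliton_rc_rigging_bound:
  assumes "set u \<subseteq> {0, 1}" "length u \<le> n" "(l, r) \<in># soliton_rc (u @ zeros n)"
  shows "r \<le> int (length u) - 2 * Q l (shape (soliton_rc (u @ zeros n)))"
  using assms
proof (induction "length u" arbitrary: u n l r rule: less_induct)
  case less
  show ?case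
  proof (cases u rule: rev_cases)
    case Nil
    then show ?thesis using less.prems by (simp add: soliton_rc_no_pairs)
  next
    case (snoc u' a)
    show ?thesis
    proof (cases "a = 1")
      case False
      show ?thesis
      proof -
        have "a = 0" using False less.prems snoc by simp
        then have w: "u @ zeros n = u' @ zeros (Suc n)" by (simp add: snoc replicate_app_Cons_same)
        show ?thesis using less.hyps[of u' "Suc n" l r] less.prems unfolding w by (simp add: snoc)
      qed
    next
      case True
      obtain n' where n: "n = Suc n'" using less.prems snoc by (cases n) auto
      have w: "u @ zeros n = u' @ 1 # 0 # zeros n'" by (simp add: snoc n True)
      let ?T = "u' @ 1 # 0 # zeros n'"
      have e: "elim10 ?T = elim10 u' @ zeros n'" using elim10_insert_pair[of u' "zeros n'"] by simp
      have len: "length (elim10 u') + 2 * card (pairs10 u') = length u'" by (rule length_elim10)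
      from less.prems(3)[unfolded w] show ?thesis
      proof (cases rule: soliton_rc_rows_cases)
        case (1 x)
        then show ?thesis
          unfolding w using solitons_le_length[of x u' n'] len Q_soliton_rc[of 0 ?T]
          by (simp add: card_pairs10_insert_pair snoc flip: One_nat_def)
      next
        case (2 l')
        have "r + 1 \<le> int (length (elim10 u')) - 2 * Q l' (shape (soliton_rc (elim10 u' @ zeros n')))"
          using 2 less.prems len set_elim10[of u']
          by (intro less.hyps) (auto simp: snoc n e)
        then show ?thesis unfolding w using len
          by (simp add: Q_soliton_rc card_pairs10_insert_pair snoc e 2)
      qed
    qed
  qed
qed

text \<open>The final 0 can be counted as padding, which lowers the bound by one.\<close>

lemma soliton_rc_rigging_strict_bound:
  assumes "set u \<subseteq> {0, 1}" "\<not> ends1 u" "length u \<le> n" "(l, r) \<in># soliton_rc (u @ zeros n)"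
  shows "r < int (length u) - 2 * Q l (shape (soliton_rc (u @ zeros n)))"
proof (cases u rule: rev_cases)
  case Nil
  then show ?thesis using assms by (simp add: soliton_rc_no_pairs)
next
  case (snoc u' a)
  then have w: "u @ zeros n = u' @ zeros (Suc n)" using assms by (simp add: replicate_app_Cons_same)
  show ?thesis
    using soliton_rc_rigging_bound[of u' "Suc n" l r] assms snoc unfolding w by simp
qed

text \<open>
  If \<open>v = elim10 u\<close> ends in 1, then appending 1 to \<open>u @ [1]\<close> leaves the solitons of the first level
  unchanged and amounts to appending 1 to \<open>v\<close>. Otherwise the last soliton of the first level is lost
  and appending 1 to \<open>v\<close> adds a row of length 1, which is a row of length 2 after raising the level.
\<close>

lemma soliton_rc_append_adjacent_one:
  assumes "set u \<subseteq> {0, 1}" "length u \<le> n"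
  defines "R \<equiv> soliton_rc (u @ 1 # 0 # zeros n)"
  defines "b \<equiv> int (length u) + 1"
  shows "\<exists>r R0. R = add_mset (r, b - 2 * Q r (shape R)) R0
    \<and> soliton_rc (u @ 1 # 1 # 0 # 0 # zeros n) = add_mset (Suc r, b - 1 - 2 * Q (Suc r) (shape R)) R0
    \<and> 1 \<le> r \<and> (\<forall>i. (i, b - 2 * Q i (shape R)) \<in># R \<longrightarrow> i \<le> r)"
  using assms(1,2) unfolding R_def b_def
proof (induction "length u" arbitrary: u n rule: less_induct)
  case less
  define v where "v = elim10 u"
  let ?T = "u @ 1 # 0 # zeros n" and ?T' = "u @ 1 # 1 # 0 # 0 # zeros n"
  have eT: "elim10 ?T = v @ zeros n"
    using elim10_insert_pair[of u "zeros n"] by (simp add: v_def)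
  have u1: "elim10 (u @ [1]) = v @ [1]" "pairs10 (u @ [1]) = pairs10 u"
      "pair_positions (u @ [1]) = pair_positions u"
    by (simp_all add: elim10_append pairs10_append pair_positions_append_no_pairs v_def)
  \<comment> \<open>Only the inner pair goes in this round; the other 1 survives and meets the
    second 0.\<close>
  have eT': "elim10 ?T' = v @ 1 # 0 # zeros n"
    using elim10_insert_pair[of "u @ [1]" "0 # zeros n"] elim10_small(3)[of "Suc n"]
    by (simp add: u1)
  have PT: "solitons ?T + right_ends (v @ zeros n) = add_mset (length v) (pair_positions u)"
    using solitons_plus_right_ends[of ?T] pair_positions_insert_pair[of "zeros n" u]
    unfolding eT by (simp add: v_def)
  have "pair_positions ?T' = add_mset (Suc (length v)) (pair_positions u)"
    using pair_positions_insert_pair[of "0 # zeros n" "u @ [1]"] pairs10_zeros[of "Suc n"]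
    by (simp add: u1)
  \<comment> \<open>The inner pair is located at the surviving 1, which opens a pair of the reduced
    word, so the two entries \<open>Suc (length v)\<close> cancel.\<close>
  then have PT': "solitons ?T' + add_mset (Suc (length v)) (right_ends v)
      = add_mset (Suc (length v)) (pair_positions u)"
    using solitons_plus_right_ends[of ?T'] right_ends_insert_pair[of "zeros n" v]
    unfolding eT' by simp
  have QT: "Q (Suc l) (shape (soliton_rc ?T))
      = int (card (pairs10 u)) + 1 + Q l (shape (soliton_rc (v @ zeros n)))" for l
    by (simp add: Q_soliton_rc card_pairs10_insert_pair eT)
  have len: "int (length u) = int (length v) + 2 * int (card (pairs10 u))"
    using length_elim10[of u] by (simp add: v_def)
  have set_v: "set v \<subseteq> {0, 1}" using set_elim10[of u] less.prems by (auto simp: v_def)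
  have len_v: "length v \<le> length u" using length_elim10[of u] by (simp add: v_def)
  show ?case
  proof (cases "ends1 v")
    case True
    then obtain v' where v': "v = v' @ [1]" by (rule ends1E)
    obtain n' where n: "n = Suc n'" using len_v v' less.prems by (cases n) auto
    have rv: "right_ends v = right_ends v'" unfolding v' by (subst right_ends_append_no_pairs) auto
    \<comment> \<open>The final 1 of \<open>v\<close>, at coordinate \<open>length v\<close>, pairs
      with a padding zero; this cancels the position of the last pair of \<open>?T\<close>.\<close>
    have "right_ends (v @ zeros n) = add_mset (length v) (right_ends v)"
      using right_ends_insert_pair[of "zeros n'" v'] rv by (simp add: v' n)
    then have "solitons ?T' + right_ends v = solitons ?T + right_ends v" using PT PT' by simp
    then have sol: "solitons ?T' = solitons ?T" by (rule add_right_imp_eq)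
    let ?R1 = "soliton_rc (v' @ 1 # 0 # zeros n')"
    have w: "v @ zeros n = v' @ 1 # 0 # zeros n'" by (simp add: v' n)
    have w': "v @ 1 # 0 # zeros n = v' @ 1 # 1 # 0 # 0 # zeros n'" by (simp add: v' n)
    have lv: "int (length v) = int (length v') + 1" by (simp add: v')
    \<comment> \<open>Both reduced words have the form treated by the induction hypothesis for
      \<open>v'\<close>, whose row of length \<open>r\<close> becomes one of length
      \<open>Suc r\<close>.\<close>
    obtain r R0 where R0: "?R1 = add_mset (r, int (length v) - 2 * Q r (shape ?R1)) R0"
      and R0': "soliton_rc (v @ 1 # 0 # zeros n) = add_mset (Suc r, int (length v) - 1 - 2 * Q (Suc r) (shape ?R1)) R0"
      and r: "1 \<le> r" "\<And>i. (i, int (length v) - 2 * Q i (shape ?R1)) \<in># ?R1 \<Longrightarrow> i \<le> r"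
      using less.hyps[of v' n'] set_v len_v less.prems unfolding v'[symmetric] lv w' by (auto simp: v' n)
    show ?thesis
    proof (intro exI conjI allI impI)
      let ?S = "level_one (solitons ?T) + raise_level R0"
      have "soliton_rc ?T = add_mset (Suc r, int (length v) - 2 * Q r (shape ?R1) - 1) ?S"
        by (subst soliton_rc_unfold) (simp only: eT w, subst R0, simp add: raise_level_def)
      then show "soliton_rc ?T = add_mset (Suc r, int (length u) + 1 - 2 * Q (Suc r) (shape (soliton_rc ?T))) ?S"
        unfolding QT w len by simp
      show "soliton_rc ?T' = add_mset (Suc (Suc r), int (length u) + 1 - 1 - 2 * Q (Suc (Suc r)) (shape (soliton_rc ?T))) ?S"
        unfolding QT w len
        by (subst soliton_rc_unfold) (simp only: eT' R0' sol, simp add: raise_level_def)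
      show "1 \<le> Suc r" by simp
      fix i assume i: "(i, int (length u) + 1 - 2 * Q i (shape (soliton_rc ?T))) \<in># soliton_rc ?T"
      then show "i \<le> Suc r"
      proof (cases rule: soliton_rc_rows_cases)
        case (2 i')
        then show ?thesis using r(2)[of i'] unfolding eT w by (simp add: QT len w)
      qed (use r in simp)
    qed
  next
    case False
    \<comment> \<open>Now nothing cancels the position \<open>length v\<close> of the last pair of
      \<open>?T\<close>. This soliton is missing in \<open>?T'\<close>; it is the row of length 1 to
      be lengthened.\<close>
    have "right_ends (v @ zeros n) = right_ends v"
      using False by (subst right_ends_append_no_pairs) auto
    then have "solitons ?T + right_ends v = add_mset (length v) (solitons ?T') + right_ends v"
      using PT PT' by simp
    then have sol: "solitons ?T = add_mset (length v) (solitons ?T')"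
      by (rule add_right_imp_eq)
    let ?R1 = "soliton_rc (v @ zeros n)"
    have lv: "int (length v) = int (length (elim10 v)) + 2 * int (card (pairs10 v))"
      using length_elim10[of v] by simp
    have Q1: "Q 1 (shape ?R1) = int (card (pairs10 v))"
      using Q_soliton_rc[of 0] by (simp add: One_nat_def pairs10_append_zeros False)
    show ?thesis
    proof (intro exI conjI allI impI)
      let ?S = "level_one (solitons ?T') + raise_level ?R1"
      show "soliton_rc ?T = add_mset (1, int (length u) + 1 - 2 * Q 1 (shape (soliton_rc ?T))) ?S"
        unfolding QT[of 0, folded One_nat_def] len
        by (subst soliton_rc_unfold) (simp only: eT sol, simp add: level_one_def)
      show "soliton_rc ?T' = add_mset (Suc 1, int (length u) + 1 - 1 - 2 * Q (Suc 1) (shape (soliton_rc ?T))) ?S"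
        unfolding QT[of 1] len Q1 lv
        by (subst soliton_rc_unfold)
           (simp only: eT' soliton_rc_append_separate_one[OF False], simp add: raise_level_def)
      show "1 \<le> (1::nat)" by simp
      fix i assume i: "(i, int (length u) + 1 - 2 * Q i (shape (soliton_rc ?T))) \<in># soliton_rc ?T"
      then show "i \<le> 1"
      proof (cases rule: soliton_rc_rows_cases)
        case (2 i')
        \<comment> \<open>A longer singular row would attain the bound for \<open>v\<close>, which
          is strict as \<open>v\<close> does not end in 1.\<close>
        then have "(i', int (length v) - 2 * Q i' (shape ?R1)) \<in># ?R1"
          unfolding eT by (simp add: QT len)
        then show ?thesis
          using soliton_rc_rigging_strict_bound[OF set_v False, of n] len_v less.prems by fastforce
      qed simp
    qed
  qed
qed

section \<open>The RC-algorithm on prefixes\<close>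

lemma one_positions_append:
  "one_positions (w @ [a]) = one_positions w @ (if a = 1 then [Suc (length w)] else [])"
proof -
  have "filter (\<lambda>c. (w @ [a]) ! (c - 1) = 1) [1..<Suc (length w)]
      = filter (\<lambda>c. w ! (c - 1) = 1) [1..<Suc (length w)]"
    by (intro filter_cong) (auto simp: nth_append)
  then show ?thesis by (simp add: one_positions_def)
qed

lemma one_positions_Nil [simp]: "one_positions [] = []"
  by (simp add: one_positions_def)

lemma one_positions_bound: "c \<in> set (one_positions w) \<Longrightarrow> c \<le> length w"
  by (auto simp: one_positions_def)

text \<open>The algorithm recurses from the front, whereas the induction on prefixes adds the last
  position.\<close>

lemma rc_continue_append:
  "rc_continue b (bs @ [b']) R = rc_insert (last (b # bs)) b' (rc_continue b bs R)"
  by (induction b bs R rule: rc_continue.induct) auto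

lemma rc_of_positions_append:
  "rc_of_positions (bs @ [b]) = (if bs = [] then add_row b {#} else rc_insert (last bs) b (rc_of_positions bs))"
  by (cases bs) (auto simp: rc_continue_append add_row_def)

lemma finite_singular_lengths: "finite (singular_lengths b R)"
  by (rule finite_subset[of _ "fst ` set_mset R"]) (force simp: singular_lengths_def)+

text \<open>Lengthening raises \<open>Q (Suc r)\<close> by one, hence the extra \<open>- 2\<close>
  when \<open>Q\<close> is taken for the old shape.\<close>

lemma lengthen_row_eq:
  assumes R: "R = add_mset (r, int b - 2 * Q r (shape R)) R0"
    and max: "\<And>i. (i, int b - 2 * Q i (shape R)) \<in># R \<Longrightarrow> i \<le> r"
  shows "lengthen_row b b' R = add_mset (Suc r, int b' - 2 - 2 * Q (Suc r) (shape R)) R0"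
proof -
  have "r \<in> singular_lengths b R"
    using R by (metis (mono_tags, lifting) mem_Collect_eq singular_lengths_def union_single_eq_member)
  then have r: "Max (singular_lengths b R) = r"
    using max finite_singular_lengths by (intro Max_eqI) (auto simp: singular_lengths_def)
  have R': "R - {#(r, int b - 2 * Q r (shape R))#} = R0"
    by (metis R add_mset_remove_trivial)
  have "shape R = add_mset r (shape R0)"
    by (metis R shape_add(3))
  then have "Q (Suc r) (shape R) = int r + Q (Suc r) (shape R0)" by simp
  then show ?thesis by (simp add: lengthen_row_def Let_def r R' flip: Suc_eq_plus1)
qed

text \<open>A final 0 joins the padding. For a final 1, whether \<open>w\<close> ends in 1 decides
  both the kind of insertion and which of the two results on appending a 1 applies.\<close>

lemma RC_eq_soliton_rc:
  assumes "set w \<subseteq> {0, 1}" "length w \<le> n"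
  shows "RC w = soliton_rc (w @ zeros n)"
  using assms
proof (induction w arbitrary: n rule: rev_induct)
  case Nil
  then show ?case by (simp add: RC_def soliton_rc_no_pairs)
next
  case (snoc a w)
  show ?case
  proof (cases "a = 1")
    case False
    then have "RC (w @ [a]) = RC w" by (simp add: RC_def one_positions_append)
    also have "\<dots> = soliton_rc (w @ zeros (Suc n))" using snoc.IH[of "Suc n"] snoc.prems by simp
    finally show ?thesis using snoc.prems False by simp
  next
    case a: True
    obtain n' where n: "n = Suc n'" using snoc.prems by (cases n) auto
    show ?thesis
    proof (cases "ends1 w")
      case True
      then obtain u where u: "w = u @ [1]" by (rule ends1E)
      obtain m where m: "n' = Suc m" using snoc.prems n u by (cases n') auto
      let ?R' = "soliton_rc (u @ 1 # 0 # zeros m)"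
      have R': "RC w = ?R'"
        using snoc.IH[of "Suc m"] snoc.prems by (simp add: n u m)
      have "last (one_positions w) = length w" "one_positions w \<noteq> []"
        by (simp_all add: u one_positions_append)
      then have "RC (w @ [a]) = lengthen_row (length w) (Suc (length w)) ?R'"
        using R' by (simp add: RC_def one_positions_append rc_of_positions_append a rc_insert_def flip: One_nat_def)
      moreover obtain r R0 where r: "?R' = add_mset (r, int (length w) - 2 * Q r (shape ?R')) R0"
          "\<And>i. (i, int (length w) - 2 * Q i (shape ?R')) \<in># ?R' \<Longrightarrow> i \<le> r"
        and R0: "soliton_rc (u @ 1 # 1 # 0 # 0 # zeros m)
          = add_mset (Suc r, int (length w) - 1 - 2 * Q (Suc r) (shape ?R')) R0"
      proof -
        have "int (length w) = int (length u) + 1" "length u \<le> m" "set u \<subseteq> {0, 1}"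
          using snoc.prems by (auto simp: u n m)
        then show thesis
          using soliton_rc_append_adjacent_one[of u m] that by (simp only:) blast
      qed
      moreover have "lengthen_row (length w) (Suc (length w)) ?R' = soliton_rc (u @ 1 # 1 # 0 # 0 # zeros m)"
        unfolding R0 by (subst lengthen_row_eq) (rule r(1), rule r(2), assumption, simp)
      ultimately have "RC (w @ [a]) = soliton_rc (u @ 1 # 1 # 0 # 0 # zeros m)" by argo
      then show ?thesis by (simp add: u a n m)
    next
      case False
      have R: "RC w = soliton_rc (w @ zeros n')" using snoc n by simp
      have "RC (w @ [a]) = add_row (Suc (length w)) (RC w)"
      proof (cases "one_positions w = []")
        case True
        then show ?thesis by (simp add: RC_def one_positions_append a add_row_def)
      next
        case nonempty: False
        then obtain w' c where w': "w = w' @ [c]" by (metis one_positions_Nil rev_exhaust)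
        \<comment> \<open>Since \<open>c\<close> is not 1, the last 1 lies strictly before the end
          of \<open>w\<close>, so the gap to the new one exceeds 1.\<close>
        have "one_positions w = one_positions w'" using False by (simp add: w' one_positions_append)
        then have "last (one_positions w) < length w"
          using nonempty one_positions_bound[of "last (one_positions w')" w'] by (simp add: w')
        then have "Suc (length w) - last (one_positions w) > 1" by linarith
        then show ?thesis using nonempty
          by (simp add: RC_def one_positions_append a rc_of_positions_append rc_insert_def)
      qed
      \<comment> \<open>There are \<open>card (pairs10 w)\<close> rows, so
        \<open>length_elim10\<close> turns the rigging of \<open>add_row\<close> into
        \<open>length (elim10 w) - 1\<close>.\<close>
      also have "\<dots> = soliton_rc (w @ 1 # 0 # zeros n')"
        using length_elim10[of w] unfolding soliton_rc_append_separate_one[OF False] R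
        by (simp add: add_row_def size_soliton_rc pairs10_append_zeros False)
      finally show ?thesis by (simp add: a n)
    qed
  qed
qed

section \<open>Removing the padding from a balanced path\<close>

fun balanced :: "nat list \<Rightarrow> bool" where
  "balanced [] = True"
| "balanced (a # w) \<longleftrightarrow> count_list (a # w) 1 \<le> count_list (a # w) 0 \<and> balanced w"

lemma balanced_iff_drop:
  "balanced w \<longleftrightarrow> (\<forall>i<length w. count_list (drop i w) 1 \<le> count_list (drop i w) 0)"
proof (induction w)
  case (Cons a w)
  have "(\<forall>i<length (a # w). count_list (drop i (a # w)) 1 \<le> count_list (drop i (a # w)) 0) \<longleftrightarrow>
    count_list (a # w) 1 \<le> count_list (a # w) 0 \<and> (\<forall>i<length w. count_list (drop i w) 1 \<le> count_list (drop i w) 0)"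
    by (simp only: length_Cons All_less_Suc2 drop_0 drop_Suc_Cons)
  with Cons show ?case by simp
qed simp

lemma balanced_not_ends1: "balanced w \<Longrightarrow> \<not> ends1 w"
  by (induction w) (auto simp: ends1_def)

text \<open>Each erased pair takes away one 1 and one 0. The count is carried along because the
  induction needs it for suffixes that begin with a surviving letter.\<close>

lemma balanced_elim10:
  "count_list (elim10 w) 1 + count_list w 0 = count_list (elim10 w) 0 + count_list w 1
    \<and> (balanced w \<longrightarrow> balanced (elim10 w))"
proof (induction "length w" arbitrary: w rule: less_induct)
  case less
  show ?case
  proof (cases w)
    case (Cons a x)
    show ?thesis
    proof (cases "a = 1 \<and> x \<noteq> [] \<and> hd x = 0")
      case True
      then obtain y where w: "w = 1 # 0 # y" using Cons by (metis list.collapse)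
      then show ?thesis using less[of y] elim10_insert_pair[of "[]" y] by auto
    next
      case False
      then have "elim10 w = a # elim10 x"
        using elim10_append[of "[a]" x] by (simp add: Cons ends1_def)
      then show ?thesis using less[of x] Cons by auto
    qed
  qed simp
qed

text \<open>A balanced word does not end in 1, so the padding forms no pair with it; balance passes
  to \<open>elim10 w\<close>, so this persists at all levels.\<close>

lemma soliton_rc_balanced_append_zeros:
  assumes "balanced w" shows "soliton_rc (w @ zeros n) = soliton_rc w"
  using assms
proof (induction w rule: soliton_rc.induct)
  case (1 w)
  note w = balanced_not_ends1[OF \<open>balanced w\<close>]
  show ?case
  proof (cases "pairs10 w = {}")
    case True
    then show ?thesis by (simp add: soliton_rc_no_pairs pairs10_append_zeros w)
  next
    case False
    have bal: "balanced (elim10 w)" using balanced_elim10 1 by blast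
    have "right_ends (elim10 w @ zeros n) = right_ends (elim10 w)"
      using balanced_not_ends1[OF bal] by (intro right_ends_append_no_pairs) auto
    moreover have "pair_positions (w @ zeros n) = pair_positions w"
      using w by (intro pair_positions_append_no_pairs) auto
    ultimately have "solitons (w @ zeros n) + right_ends (elim10 w) = solitons w + right_ends (elim10 w)"
      using solitons_plus_right_ends[of w] solitons_plus_right_ends[of "w @ zeros n"]
      by (simp add: elim10_zeros w)
    then have "solitons (w @ zeros n) = solitons w" by (rule add_right_imp_eq)
    then show ?thesis using 1(1)[OF False bal]
      by (simp add: soliton_rc_unfold[of w] soliton_rc_unfold[of "w @ zeros n"] elim10_zeros w)
  qed
qed

section \<open>Riggings level by level and the conjugate partition\<close>

lemma zero_solitons_Suc: "zero_solitons w (Suc k) = solitons (E k w)"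
  by (simp add: zero_solitons_def solitons_def Let_def)

lemma E_elim10: "E k (elim10 w) = E (Suc k) w"
  by (simp add: E_def funpow_swap1)

lemma riggings_add: "riggings (R + R') l = riggings R l + riggings R' l"
  by (simp add: riggings_def)

lemma riggings_level_one:
  "riggings (level_one M) (Suc l) = (if l = 0 then image_mset (\<lambda>x. int x - 1) M else {#})"
  by (induction M) (auto simp: riggings_def level_one_def One_nat_def)

lemma riggings_raise_level:
  "riggings (raise_level R) (Suc l) = image_mset (\<lambda>r. r - 1) (riggings R l)"
  by (induction R) (auto simp: riggings_def raise_level_def)

lemma soliton_rc_positive_rows: "(0, r) \<notin># soliton_rc w"
  by (auto elim: soliton_rc_rows_cases)

lemma riggings_soliton_rc_0: "riggings (soliton_rc w) 0 = {#}"
  using soliton_rc_positive_rows[of _ w] unfolding riggings_def image_mset_is_empty_iff filter_mset_eq_mempty_iff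
  by (metis prod.collapse)

text \<open>\<open>level_one\<close> and every \<open>raise_level\<close> subtract one each, which
  adds up to the level.\<close>

lemma riggings_soliton_rc:
  "riggings (soliton_rc w) (Suc k) = image_mset (\<lambda>x. int x - int (Suc k)) (zero_solitons w (Suc k))"
proof (induction k arbitrary: w)
  case 0
  have "riggings (soliton_rc (elim10 w)) 0 = {#}"
    by (rule riggings_soliton_rc_0)
  then show ?case
    by (subst soliton_rc_unfold) (simp add: riggings_add riggings_level_one riggings_raise_level zero_solitons_Suc E_def)
next
  case (Suc k)
  show ?case
    by (subst soliton_rc_unfold)
       (simp add: riggings_add riggings_level_one riggings_raise_level Suc.IH zero_solitons_Suc E_elim10 algebra_simps multiset.map_comp comp_def)
qed

lemma num10_Suc: "size (zero_solitons w (Suc k)) + num10 w (Suc k) = num10 w k"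
  using size_solitons[of "E k w"] by (simp add: zero_solitons_Suc num10_def E_def)

lemma antimono_num10: "antimono (num10 w)"
  unfolding antimono_iff_le_Suc using num10_Suc[of w] by (metis le_add2)

lemma num10_0_if_large: "length w \<le> k \<Longrightarrow> num10 w k = 0"
proof (induction "length w" arbitrary: w k rule: less_induct)
  case less
  show ?case
  proof (cases "pairs10 w = {}")
    case True
    have "E k w = w" unfolding E_def by (induction k) (simp_all add: elim10_no_pairs True)
    then show ?thesis by (simp add: num10_def True)
  next
    case False
    then have l: "length (elim10 w) < length w" by (rule length_elim10_less)
    then obtain k' where k: "k = Suc k'" using less.prems by (cases k) auto
    have "num10 (elim10 w) k' = 0" using less.hyps[OF l, of k'] l less.prems k by simp
    then show ?thesis by (simp add: num10_def k E_elim10)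
  qed
qed

text \<open>For \<open>j \<ge> 1\<close> the set \<open>{i. j \<le> e i}\<close> is a finite initial
  segment, so its size exceeds \<open>n\<close> exactly when \<open>j \<le> e n\<close>. Parts equal
  to \<open>Suc k\<close> thus come from \<open>e (Suc k) < j \<le> e k\<close>.\<close>

lemma count_conjugate:
  assumes e: "antimono e" and K: "e K = 0"
  shows "count (conjugate e) (Suc k) = e k - e (Suc k)"
proof -
  have mono: "e i \<le> e k" if "k \<le> i" for i k using antimonoD[OF e that] .
  have eq: "card {i. j \<le> e i} = Suc k \<longleftrightarrow> j \<in> {e (Suc k)<..e k}" if "j \<ge> 1" for j
  proof -
    have "{i. j \<le> e i} \<subseteq> {..<K}"
    proof
      fix i assume "i \<in> {i. j \<le> e i}"
      then have "e i \<noteq> e K" using that K by simp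
      then have "\<not> K \<le> i" using mono[of K i] K by auto
      then show "i \<in> {..<K}" by simp
    qed
    then have fin: "finite {i. j \<le> e i}" by (rule finite_subset) simp
    have le: "n < card {i. j \<le> e i} \<longleftrightarrow> j \<le> e n" for n
    proof
      assume j: "j \<le> e n"
      have "{..n} \<subseteq> {i. j \<le> e i}"
      proof
        fix i assume "i \<in> {..n}"
        then show "i \<in> {i. j \<le> e i}" using mono[of i n] j by simp
      qed
      from card_mono[OF fin this] show "n < card {i. j \<le> e i}" by simp
    next
      assume n: "n < card {i. j \<le> e i}"
      show "j \<le> e n"
      proof (rule ccontr)
        assume j: "\<not> j \<le> e n"
        have "{i. j \<le> e i} \<subseteq> {..<n}"
        proof
          fix i assume "i \<in> {i. j \<le> e i}"
          then have "\<not> n \<le> i" using mono[of n i] j by auto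
          then show "i \<in> {..<n}" by simp
        qed
        then have "card {i. j \<le> e i} \<le> card {..<n}" by (rule card_mono[rotated]) simp
        then show False using n by simp
      qed
    qed
    show ?thesis using le[of k] le[of "Suc k"] by auto
  qed
  have "{j \<in> {1..e 0}. card {i. j \<le> e i} = Suc k} = {e (Suc k)<..e k}"
  proof (intro set_eqI iffI)
    fix j assume "j \<in> {j \<in> {1..e 0}. card {i. j \<le> e i} = Suc k}"
    then show "j \<in> {e (Suc k)<..e k}" using eq[of j] by simp
  next
    fix j assume j: "j \<in> {e (Suc k)<..e k}"
    then have "1 \<le> j" by simp
    then show "j \<in> {j \<in> {1..e 0}. card {i. j \<le> e i} = Suc k}"
      using j eq[of j] mono[of 0 k] by simp
  qed
  then have "card ((\<lambda>j. card {i. j \<le> e i}) -` {Suc k} \<inter> {1..e 0}) = e k - e (Suc k)"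
    by (simp add: vimage_def Int_def conj_commute)
  then show ?thesis by (simp add: conjugate_def count_image_mset)
qed

lemma size_zero_solitons: "size (zero_solitons w (Suc k)) = count (conjugate (num10 w)) (Suc k)"
  using num10_Suc[of w k] count_conjugate[OF antimono_num10 num10_0_if_large[OF order_refl], of w k]
  by simp

section \<open>Translation into the form of the theorem\<close>

lemma count_list_drop:
  "count_list (drop i w) a = card {c \<in> {Suc i..length w}. w ! (c - 1) = a}"
proof -
  have "count_list (drop i w) a = card {j. j < length w - i \<and> w ! (i + j) = a}"
    by (auto simp: count_list_eq_length_filter length_filter_conv_card intro!: arg_cong[where f = card])
  also have "\<dots> = card ((\<lambda>j. Suc (i + j)) ` {j. j < length w - i \<and> w ! (i + j) = a})"
    by (rule card_image[symmetric]) (simp add: inj_on_def)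
  also have "(\<lambda>j. Suc (i + j)) ` {j. j < length w - i \<and> w ! (i + j) = a}
      = {c \<in> {Suc i..length w}. w ! (c - 1) = a}"
  proof (intro set_eqI iffI)
    fix c assume "c \<in> {c \<in> {Suc i..length w}. w ! (c - 1) = a}"
    then show "c \<in> (\<lambda>j. Suc (i + j)) ` {j. j < length w - i \<and> w ! (i + j) = a}"
      by (intro image_eqI[of _ _ "c - Suc i"]) (auto simp: One_nat_def)
  qed (auto simp: One_nat_def)
  finally show ?thesis .
qed

lemma sorted_list_of_multiset_image_mono:
  fixes f :: "'a::linorder \<Rightarrow> 'b::linorder"
  assumes "mono f"
  shows "sorted_list_of_multiset (image_mset f M) = map f (sorted_list_of_multiset M)"
proof -
  let ?xs = "sorted_list_of_multiset M"
  have "sorted (map f ?xs)"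
    unfolding sorted_wrt_map
    by (rule sorted_wrt_mono_rel[OF _ sorted_sorted_list_of_multiset]) (simp add: monoD[OF assms])
  moreover have "image_mset f M = mset (map f ?xs)" by simp
  ultimately show ?thesis by (simp only: sorted_list_of_multiset_mset sorted_sort_id)
qed

lemma sum_singletons_nth:
  "(\<Sum>\<alpha>\<in>{1..length xs}. {#f (xs ! (\<alpha> - 1))#}) = image_mset f (mset xs)"
proof (induction xs rule: rev_induct)
  case (snoc x xs)
  have "(\<Sum>\<alpha>\<in>{1..length xs}. {#f ((xs @ [x]) ! (\<alpha> - 1))#}) = (\<Sum>\<alpha>\<in>{1..length xs}. {#f (xs ! (\<alpha> - 1))#})"
    by (intro sum.cong) (auto simp: nth_append)
  with snoc show ?case by simp
qed simp

lemma image_Pair_riggings: "image_mset (Pair l) (riggings R l) = filter_mset (\<lambda>row. fst row = l) R"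
  by (induction R) (auto simp: riggings_def)

lemma count_shape: "count (shape R) l = size (riggings R l)"
  by (induction R) (auto simp: shape_def riggings_def)

theorem theorem4p3:
  fixes p :: "nat list" and N s :: nat and L m :: "nat \<Rightarrow> nat"
  assumes "N \<ge> 1" and "length p = N" and "set p \<subseteq> {0, 1}"
    and "\<forall>i\<in>{1..N}. card {c\<in>{i..N}. p ! (c - 1) = 1} \<le> card {c\<in>{i..N}. p ! (c - 1) = 0}"
    and "\<forall>i\<in>{1..s}. \<forall>j\<in>{1..s}. i < j \<longrightarrow> L i > L j"
    and "\<forall>i\<in>{1..s}. L i \<ge> 1 \<and> m (L i) \<ge> 1"
    and "conjugate (num10 p) = (\<Sum>i\<in>{1..s}. replicate_mset (m (L i)) (L i))"
  shows "RC p = (\<Sum>i\<in>{1..s}. \<Sum>\<alpha>\<in>{1..m (L i)}.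
                   {#(L i, int (zero_soliton_list p (L i) ! (\<alpha> - 1)) - int (L i))#})
    \<and> shape (RC p) = (\<Sum>i\<in>{1..s}. replicate_mset (m (L i)) (L i))
    \<and> (\<forall>i\<in>{1..s}. sorted_list_of_multiset (riggings (RC p) (L i))
          = map (\<lambda>x. int x - int (L i)) (zero_soliton_list p (L i)))"
proof -
  let ?R = "RC p"
  have "balanced p"
    unfolding balanced_iff_drop count_list_drop using assms(2,4) by (auto simp: One_nat_def)
  \<comment> \<open>\<open>length p\<close> zeros suffice as padding, and balance lets them be
    dropped again.\<close>
  then have RC: "?R = soliton_rc p"
    using RC_eq_soliton_rc[OF assms(3) order_refl] soliton_rc_balanced_append_zeros by simp
  have rig: "riggings ?R l = image_mset (\<lambda>x. int x - int l) (zero_solitons p l)"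
    and size: "size (zero_solitons p l) = count (conjugate (num10 p)) l" if "l \<ge> 1" for l
    using that riggings_soliton_rc[of p "l - 1"] size_zero_solitons[of p "l - 1"]
    by (simp_all add: RC)
  have inj: "L i = L j \<longleftrightarrow> i = j" if "i \<in> {1..s}" "j \<in> {1..s}" for i j
    using assms(5) that by (metis less_irrefl linorder_neqE_nat)
  have mult: "count (conjugate (num10 p)) (L i) = m (L i)" if i: "i \<in> {1..s}" for i
  proof -
    have "count (conjugate (num10 p)) (L i) = (\<Sum>j\<in>{1..s}. if j = i then m (L j) else 0)"
      unfolding assms(7) count_sum using inj[OF i] by (intro sum.cong) auto
    then show ?thesis using i by simp
  qed
  \<comment> \<open>Multiplicities are compared: rows of length \<open>l\<close> correspond to
    solitons of level \<open>l\<close>, and length 0 occurs on neither side.\<close>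
  have shape: "shape ?R = conjugate (num10 p)"
  proof (rule multiset_eqI)
    fix l
    show "count (shape ?R) l = count (conjugate (num10 p)) l"
    proof (cases "l = 0")
      case True
      have "count (conjugate (num10 p)) 0 = 0"
        unfolding assms(7) count_sum using assms(6) by (intro sum.neutral) auto
      then show ?thesis using True by (simp add: count_shape RC riggings_soliton_rc_0)
    next
      case False
      then have "l \<ge> 1" by simp
      then show ?thesis by (simp add: count_shape rig size)
    qed
  qed
  have "(\<Sum>\<alpha>\<in>{1..m (L i)}. {#(L i, int (zero_soliton_list p (L i) ! (\<alpha> - 1)) - int (L i))#})
      = filter_mset (\<lambda>row. fst row = L i) ?R" if i: "i \<in> {1..s}" for i
  proof -
    have l: "L i \<ge> 1" using assms(6) i by blast
    \<comment> \<open>With this length the indices \<alpha> run exactly through the list of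
      solitons.\<close>
    have "length (zero_soliton_list p (L i)) = m (L i)"
      using size[OF l] mult[OF i] unfolding zero_soliton_list_def
      by (metis mset_sorted_list_of_multiset size_mset)
    then show ?thesis
      using sum_singletons_nth[of "\<lambda>x. (L i, int x - int (L i))" "zero_soliton_list p (L i)"]
      unfolding image_Pair_riggings[symmetric] rig[OF l]
      by (simp add: zero_soliton_list_def multiset.map_comp comp_def)
  qed
  \<comment> \<open>The \<open>L i\<close> are distinct and, by the shape, exhaust the row lengths,
    so exactly one \<open>i\<close> selects each row.\<close>
  moreover have "(\<Sum>i\<in>{1..s}. filter_mset (\<lambda>row. fst row = L i) ?R) = ?R"
  proof (rule multiset_eqI)
    fix row
    have *: "count (\<Sum>i\<in>{1..s}. filter_mset (\<lambda>row. fst row = L i) ?R) row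
        = (\<Sum>i\<in>{1..s}. if fst row = L i then count ?R row else 0)"
      by (simp add: count_sum)
    show "count (\<Sum>i\<in>{1..s}. filter_mset (\<lambda>row. fst row = L i) ?R) row = count ?R row"
    proof (cases "row \<in># ?R")
      case True
      then have "fst row \<in># shape ?R" by (simp add: shape_def)
      then have "(\<Sum>i\<in>{1..s}. count (replicate_mset (m (L i)) (L i)) (fst row)) \<noteq> 0"
        unfolding shape assms(7) count_sum[symmetric] by (simp only: count_eq_zero_iff not_not)
      then obtain j where j: "j \<in> {1..s}" "count (replicate_mset (m (L j)) (L j)) (fst row) \<noteq> 0"
        by (rule sum.not_neutral_contains_not_neutral)
      then have "fst row = L j" by (simp split: if_splits)
      note j = j(1) this
      have "(\<Sum>i\<in>{1..s}. if fst row = L i then count ?R row else 0) = (\<Sum>i\<in>{1..s}. if i = j then count ?R row else 0)"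
        using inj[OF j(1)] j(2) by (intro sum.cong) auto
      then show ?thesis unfolding * using j by simp
    next
      case False
      then have "count ?R row = 0" by (simp add: not_in_iff)
      then show ?thesis unfolding * by simp
    qed
  qed
  moreover have "sorted_list_of_multiset (riggings ?R (L i))
      = map (\<lambda>x. int x - int (L i)) (zero_soliton_list p (L i))" if "i \<in> {1..s}" for i
    using assms(6) that unfolding zero_soliton_list_def
    by (subst rig) (auto intro!: sorted_list_of_multiset_image_mono monoI)
  ultimately show ?thesis using shape assms(7) by simp
qed

end
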